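(* Let $(M,F)$ be a Finsler surface with nonflat geodesic spray $S$, and let $(H,S,V,\mathcal{C})$ be its Berwald frame. Suppose $V(\rho)=-\mathcal{I}$. If either $S(\rho)=0$ or $S(\mathcal{J})=0$, then $(M,F)$ is Riemannian.
   Context: $M$ is a $2$-dimensional smooth manifold, $\mathcal{T}M$ its tangent bundle with the zero section removed, with induced coordinates $(x^i,y^i)$; $J=\frac{\partial}{\partial y^i}\otimes dx^i$ is the almost-tangent structure and $\mathcal{C}=y^i\frac{\partial}{\partial y^i}$ the Liouville vector field. $F:TM\to\mathbb{R}$ is a Finsler function: smooth and positive on $\mathcal{T}M$, zero exactly on the zero section, positively $1$-homogeneous in $y$, with $g_{ij}=\frac12\frac{\partial^2F^2}{\partial y^i\partial y^j}$ of maximal rank on $\mathcal{T}M$. $S=y^i\frac{\partial}{\partial x^i}-2G^i\frac{\partial}{\partial y^i}$ is its geodesic spray, and "horizontal" refers to the image of the projector $h=\frac12(Id+[J,S])$ (Frölicher–Nijenhuis bracket). With $G^i_j=\partial G^i/\partial y^j$, the Jacobi endomorphism is $\Phi=\big(2\frac{\partial G^i}{\partial x^j}-S(G^i_j)-G^i_kG^k_j\big)\frac{\partial}{\partial y^i}\otimes dx^j$; in dimension $2$ one has $\Phi=K(F^2J-F\,d_JF\otimes\mathcal{C})$, where $K\in C^\infty(\mathcal{T}M)$ is the flag curvature; the Ricci scalar is $\rho=KF^2$. $S$ is nonflat: $K$ vanishes nowhere on $\mathcal{T}M$. Berwald frame: $H$ is a horizontal vector field on $\mathcal{T}M$ with $[\mathcal{C},H]=H$,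 $d_JF(H)=0$, $V:=JH$, normalized so that $[S,H]=\rho V$, $[V,S]=H$, $[H,V]=S+\mathcal{I}H+\mathcal{J}V$ with $\mathcal{J}=S(\mathcal{I})$. Here $\mathcal{I}$ is the main (Cartan) scalar and $\mathcal{J}$ the Landsberg scalar. $H,S,V$ annihilate $F$ (so $V(\rho)=-\mathcal{I}$ is equivalent to $V(K)=-\mathcal{I}/F^2$, and $S(\rho)=0$ to $S(K)=0$). $(M,F)$ is Riemannian when $F^2$ is a quadratic form in $y$, equivalently $\mathcal{I}=0$. *)

theory Defs
  imports "HOL-Analysis.Analysis"
begin

text \<open>
  For an open set \<open>U\<close>, \<open>Ck_on k U f\<close> says that \<open>f\<close> is \<open>k\<close> times continuously differentiable on
  \<open>U\<close>: all iterated directional derivatives up to order \<open>k\<close> exist and those of order \<open>k\<close> are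
  continuous.
\<close>

primrec Ck_on ::
  "nat \<Rightarrow> 'a::real_normed_vector set \<Rightarrow> ('a \<Rightarrow> 'b::real_normed_vector) \<Rightarrow> bool" where
  "Ck_on 0 U f \<longleftrightarrow> continuous_on U f"
| "Ck_on (Suc k) U f \<longleftrightarrow>
     (\<forall>x\<in>U. f differentiable (at x)) \<and>
     (\<forall>v. Ck_on k U (\<lambda>x. frechet_derivative f (at x) v))"

definition smooth_on ::
  "'a::real_normed_vector set \<Rightarrow> ('a \<Rightarrow> 'b::real_normed_vector) \<Rightarrow> bool" where
  "smooth_on U f \<longleftrightarrow> (\<forall>k. Ck_on k U f)"


section \<open>Smooth surfaces and their tangent bundle\<close>

text \<open>
  A chart is a pair of its domain and its coordinate map; the values of the coordinate map outside
  the domain are irrelevant.  A smooth surface is a second countable Hausdorff type together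
  with a (not necessarily maximal) smooth atlas.
\<close>

type_synonym 'a chart = "'a set \<times> ('a \<Rightarrow> real^2)"

abbreviation chart_image :: "'a chart \<Rightarrow> (real^2) set" where
  "chart_image c \<equiv> snd c ` fst c"

abbreviation chart_inv :: "'a chart \<Rightarrow> real^2 \<Rightarrow> 'a" where
  "chart_inv c \<equiv> inv_into (fst c) (snd c)"

definition transition :: "'a chart \<Rightarrow> 'a chart \<Rightarrow> real^2 \<Rightarrow> real^2" where
  "transition c d = snd d \<circ> chart_inv c"

definition smooth_atlas ::
  "'a::{t2_space, second_countable_topology} chart set \<Rightarrow> bool" where
  "smooth_atlas A \<longleftrightarrow>
     (\<Union>c\<in>A. fst c) = UNIV \<and>
     (\<forall>c\<in>A. open (fst c) \<and> open (chart_image c) \<and>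
        homeomorphism (fst c) (chart_image c) (snd c) (chart_inv c)) \<and>
     (\<forall>c\<in>A. \<forall>d\<in>A. smooth_on (snd c ` (fst c \<inter> fst d)) (transition c d))"

text \<open>
  A tangent vector at \<open>p\<close> is a family of components, one vector of \<open>\<real>\<^sup>2\<close> for every chart around
  \<open>p\<close>, transforming by the differentials of the transition maps; the entries at all other charts
  are set to \<open>0\<close> so that equality of tangent vectors is equality in HOL.
\<close>

type_synonym 'a tvec = "'a \<times> ('a chart \<Rightarrow> real^2)"

definition tangent_bundle :: "'a chart set \<Rightarrow> 'a tvec set" where
  "tangent_bundle A = {(p, \<xi>).
     (\<forall>c\<in>A. \<forall>d\<in>A. p \<in> fst c \<and> p \<in> fst d \<longrightarrow>
        \<xi> d = frechet_derivative (transition c d) (at (snd c p)) (\<xi> c)) \<and>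
     (\<forall>c. c \<notin> A \<or> p \<notin> fst c \<longrightarrow> \<xi> c = 0)}"

definition zero_section :: "'a tvec set" where
  "zero_section = {(p, \<xi>). \<xi> = (\<lambda>c. 0)}"

definition slit_bundle :: "'a chart set \<Rightarrow> 'a tvec set" where
  "slit_bundle A = tangent_bundle A - zero_section"

text \<open>
  The induced coordinates \<open>(x, y)\<close> on the part of the tangent bundle over a chart domain, and
  the coordinate range of the slit tangent bundle.
\<close>

definition tcoord :: "'a chart \<Rightarrow> 'a tvec \<Rightarrow> (real^2) \<times> (real^2)" where
  "tcoord c u = (snd c (fst u), snd u c)"

definition tinv :: "'a chart set \<Rightarrow> 'a chart \<Rightarrow> (real^2) \<times> (real^2) \<Rightarrow> 'a tvec" where
  "tinv A c = inv_into {u \<in> tangent_bundle A. fst u \<in> fst c} (tcoord c)"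

definition slit :: "'a chart \<Rightarrow> ((real^2) \<times> (real^2)) set" where
  "slit c = chart_image c \<times> (- {0})"

definition local_rep ::
  "'a chart set \<Rightarrow> ('a tvec \<Rightarrow> real) \<Rightarrow> 'a chart \<Rightarrow> (real^2) \<times> (real^2) \<Rightarrow> real" where
  "local_rep A f c = f \<circ> tinv A c"

definition smooth_scalar :: "'a chart set \<Rightarrow> ('a tvec \<Rightarrow> real) \<Rightarrow> bool" where
  "smooth_scalar A f \<longleftrightarrow> (\<forall>c\<in>A. smooth_on (slit c) (local_rep A f c))"

text \<open>
  A vector field on the slit tangent bundle is given by its components in all induced charts.  A
  pair \<open>(a, b)\<close> stands for \<open>a\<^sup>i \<partial>/\<partial>x\<^sup>i + b\<^sup>i \<partial>/\<partial>y\<^sup>i\<close>.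
\<close>

type_synonym local_field = "(real^2) \<times> (real^2) \<Rightarrow> (real^2) \<times> (real^2)"

type_synonym 'a field = "'a chart \<Rightarrow> local_field"

definition vector_field :: "'a chart set \<Rightarrow> 'a field \<Rightarrow> bool" where
  "vector_field A X \<longleftrightarrow>
     (\<forall>c\<in>A. smooth_on (slit c) (X c)) \<and>
     (\<forall>c\<in>A. \<forall>d\<in>A. \<forall>u\<in>slit_bundle A. fst u \<in> fst c \<and> fst u \<in> fst d \<longrightarrow>
        X d (tcoord d u) =
          frechet_derivative (tcoord d \<circ> tinv A c) (at (tcoord c u)) (X c (tcoord c u)))"

definition lie_deriv ::
  "local_field \<Rightarrow> ((real^2) \<times> (real^2) \<Rightarrow> real) \<Rightarrow> (real^2) \<times> (real^2) \<Rightarrow> real" where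
  "lie_deriv X f z = frechet_derivative f (at z) (X z)"

definition lie_bracket :: "local_field \<Rightarrow> local_field \<Rightarrow> local_field" where
  "lie_bracket X Y z = frechet_derivative Y (at z) (X z) - frechet_derivative X (at z) (Y z)"

definition dx :: "2 \<Rightarrow> ((real^2) \<times> (real^2) \<Rightarrow> real) \<Rightarrow> (real^2) \<times> (real^2) \<Rightarrow> real" where
  "dx i f z = frechet_derivative f (at z) (axis i 1, 0)"

definition dy :: "2 \<Rightarrow> ((real^2) \<times> (real^2) \<Rightarrow> real) \<Rightarrow> (real^2) \<times> (real^2) \<Rightarrow> real" where
  "dy i f z = frechet_derivative f (at z) (0, axis i 1)"

definition tangent_structure :: "(real^2) \<times> (real^2) \<Rightarrow> (real^2) \<times> (real^2)" where
  "tangent_structure w = (0, fst w)"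

definition liouville :: local_field where
  "liouville z = (0, snd z)"


section \<open>Finsler functions\<close>

definition metric ::
  "'a chart set \<Rightarrow> ('a tvec \<Rightarrow> real) \<Rightarrow> 'a chart \<Rightarrow> (real^2) \<times> (real^2) \<Rightarrow> real^2^2" where
  "metric A F c z = (\<chi> i j. (1/2) * dy i (dy j (\<lambda>w. (local_rep A F c w)\<^sup>2)) z)"

definition finsler_function :: "'a chart set \<Rightarrow> ('a tvec \<Rightarrow> real) \<Rightarrow> bool" where
  "finsler_function A F \<longleftrightarrow>
     smooth_scalar A F \<and>
     (\<forall>u\<in>slit_bundle A. F u > 0) \<and>
     (\<forall>u\<in>tangent_bundle A. F u = 0 \<longleftrightarrow> u \<in> zero_section) \<and>
     (\<forall>(p, \<xi>)\<in>tangent_bundle A. \<forall>t>0. F (p, \<lambda>c. t *\<^sub>R \<xi> c) = t * F (p, \<xi>)) \<and>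
     (\<forall>c\<in>A. \<forall>z\<in>slit c. rank (metric A F c z) = 2)"

definition riemannian :: "'a chart set \<Rightarrow> ('a tvec \<Rightarrow> real) \<Rightarrow> bool" where
  "riemannian A F \<longleftrightarrow>
     (\<forall>c\<in>A. \<forall>x\<in>chart_image c. \<exists>a::real^2^2. \<forall>y.
        (local_rep A F c (x, y))\<^sup>2 = (\<Sum>i\<in>UNIV. \<Sum>j\<in>UNIV. a $ i $ j * y $ i * y $ j))"

text \<open>
  The coefficients \<open>G\<^sup>i = 1/4 g\<^sup>i\<^sup>l (y\<^sup>k \<partial>\<^sup>2F\<^sup>2/\<partial>x\<^sup>k\<partial>y\<^sup>l - \<partial>F\<^sup>2/\<partial>x\<^sup>l)\<close> of the geodesic spray, i.e. the unique
  solution of the Euler--Lagrange equations \<open>S(\<partial>F\<^sup>2/\<partial>y\<^sup>l) = \<partial>F\<^sup>2/\<partial>x\<^sup>l\<close>.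
\<close>

definition spray_coeff ::
  "'a chart set \<Rightarrow> ('a tvec \<Rightarrow> real) \<Rightarrow> 'a chart \<Rightarrow> (real^2) \<times> (real^2) \<Rightarrow> real^2" where
  "spray_coeff A F c z =
     (let F2 = (\<lambda>w. (local_rep A F c w)\<^sup>2) in
      (1/4) *\<^sub>R (matrix_inv (metric A F c z) *v
        (\<chi> l. (\<Sum>k\<in>UNIV. snd z $ k * dx k (dy l F2) z) - dx l F2 z)))"

definition geodesic_spray :: "'a chart set \<Rightarrow> ('a tvec \<Rightarrow> real) \<Rightarrow> 'a field" where
  "geodesic_spray A F c z = (snd z, - (2 *\<^sub>R spray_coeff A F c z))"

text \<open>
  \<open>h = 1/2 (Id + [J, S])\<close>, where the Froelicher--Nijenhuis bracket of the vector valued one-form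
  \<open>J\<close> with the vector field \<open>S\<close> is \<open>[J, S] X = [J X, S] - J [X, S]\<close>.
\<close>

definition hor_proj :: "local_field \<Rightarrow> local_field \<Rightarrow> local_field" where
  "hor_proj S X z = (1/2) *\<^sub>R (X z +
     (lie_bracket (\<lambda>w. tangent_structure (X w)) S z - tangent_structure (lie_bracket X S z)))"

definition horizontal :: "'a chart set \<Rightarrow> ('a tvec \<Rightarrow> real) \<Rightarrow> 'a field \<Rightarrow> bool" where
  "horizontal A F X \<longleftrightarrow> (\<exists>Y. vector_field A Y \<and>
     (\<forall>c\<in>A. \<forall>z\<in>slit c. X c z = hor_proj (geodesic_spray A F c) (Y c) z))"

text \<open>\<open>spray_conn A F c i j\<close> is \<open>G\<^sup>i\<^sub>j = \<partial>G\<^sup>i/\<partial>y\<^sup>j\<close>.\<close>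

definition spray_conn ::
  "'a chart set \<Rightarrow> ('a tvec \<Rightarrow> real) \<Rightarrow> 'a chart \<Rightarrow> 2 \<Rightarrow> 2 \<Rightarrow> (real^2) \<times> (real^2) \<Rightarrow> real" where
  "spray_conn A F c i j = dy j (\<lambda>w. spray_coeff A F c w $ i)"

definition jacobi_endo ::
  "'a chart set \<Rightarrow> ('a tvec \<Rightarrow> real) \<Rightarrow> 'a chart \<Rightarrow> (real^2) \<times> (real^2)
     \<Rightarrow> (real^2) \<times> (real^2) \<Rightarrow> (real^2) \<times> (real^2)" where
  "jacobi_endo A F c z w =
     (0, (\<chi> i j. 2 * dx j (\<lambda>z. spray_coeff A F c z $ i) z
            - lie_deriv (geodesic_spray A F c) (spray_conn A F c i j) z
            - (\<Sum>k\<in>UNIV. spray_conn A F c i k z * spray_conn A F c k j z)) *v fst w)"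

text \<open>\<open>d\<^sub>J f = df \<circ> J\<close>, applied to the tangent vector \<open>w\<close> at \<open>z\<close>.\<close>

definition dJ ::
  "((real^2) \<times> (real^2) \<Rightarrow> real) \<Rightarrow> (real^2) \<times> (real^2) \<Rightarrow> (real^2) \<times> (real^2) \<Rightarrow> real" where
  "dJ f z w = frechet_derivative f (at z) (tangent_structure w)"

text \<open>
  The flag curvature is the function \<open>K\<close> with \<open>\<Phi> = K (F\<^sup>2 J - F d\<^sub>JF \<otimes> C)\<close>.  It is unique on the
  slit tangent bundle, and exists for every Finsler surface.
\<close>

definition flag_curvature ::
  "'a chart set \<Rightarrow> ('a tvec \<Rightarrow> real) \<Rightarrow> ('a tvec \<Rightarrow> real) \<Rightarrow> bool" where
  "flag_curvature A F K \<longleftrightarrow>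
     smooth_scalar A K \<and>
     (\<forall>c\<in>A. \<forall>z\<in>slit c. \<forall>w.
        jacobi_endo A F c z w =
          local_rep A K c z *\<^sub>R
            ((local_rep A F c z)\<^sup>2 *\<^sub>R tangent_structure w
             - (local_rep A F c z * dJ (local_rep A F c) z w) *\<^sub>R liouville z))"

definition ricci_scalar ::
  "('a tvec \<Rightarrow> real) \<Rightarrow> ('a tvec \<Rightarrow> real) \<Rightarrow> 'a tvec \<Rightarrow> real" where
  "ricci_scalar F K u = K u * (F u)\<^sup>2"

definition vertical_part :: "'a field \<Rightarrow> 'a field" where
  "vertical_part X c z = tangent_structure (X c z)"

text \<open>
  The Berwald frame \<open>(H, S, V, C)\<close>, where \<open>S\<close> is the geodesic spray and \<open>V = J H\<close>.  The
  arguments \<open>mI\<close> and \<open>mJ\<close> are the main scalar and the Landsberg scalar; they are determined by the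
  structure equation for \<open>[H, V]\<close>.
\<close>

definition berwald_frame ::
  "'a chart set \<Rightarrow> ('a tvec \<Rightarrow> real) \<Rightarrow> ('a tvec \<Rightarrow> real) \<Rightarrow> 'a field
     \<Rightarrow> ('a tvec \<Rightarrow> real) \<Rightarrow> ('a tvec \<Rightarrow> real) \<Rightarrow> bool" where
  "berwald_frame A F K H mI mJ \<longleftrightarrow>
     vector_field A H \<and> horizontal A F H \<and> smooth_scalar A mI \<and> smooth_scalar A mJ \<and>
     (\<forall>c\<in>A. \<forall>z\<in>slit c.
        let S = geodesic_spray A F c; V = vertical_part H c;
            \<rho> = local_rep A (ricci_scalar F K) c in
        lie_bracket liouville (H c) z = H c z \<and>
        dJ (local_rep A F c) z (H c z) = 0 \<and>
        lie_bracket S (H c) z = \<rho> z *\<^sub>R V z \<and>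
        lie_bracket V S z = H c z \<and>
        lie_bracket (H c) V z =
          S z + local_rep A mI c z *\<^sub>R H c z + local_rep A mJ c z *\<^sub>R V z \<and>
        local_rep A mJ c z = lie_deriv S (local_rep A mI c) z)"

end

theory Submission
  imports Defs
begin

text \<open>
  The reason is homogeneity along the fibres.  In a chart write \<open>H = (a, b)\<close>, so that \<open>V = (0, a)\<close>, and
  let \<open>D\<^sub>y a\<close> be the derivative of \<open>a\<close> in the fibre variable \<open>y\<close>.  The equation \<open>[C, H] = H\<close> says that
  \<open>a\<close> has degree \<open>1\<close> and \<open>b\<close> degree \<open>2\<close> under \<open>y \<mapsto> t y\<close> (Euler).  The remaining
  structure equations then fix the degrees of everything else:

  \<^item> \<open>[H, V]\<close> gives \<open>D\<^sub>y a (a) = - (y + I a)\<close>; the left side has degree \<open>1\<close> and \<open>a\<close> never vanishes, so \<open>I\<close>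
    has degree \<open>0\<close> (\<open>I_fibre_scale\<close>).
  \<^item> \<open>[S, H] = \<rho> V\<close> gives \<open>Da (S) = b\<close>.  As \<open>D\<^sub>y a\<close> is injective, this determines the \<open>y\<close>-component of \<open>S\<close>,
    which therefore has degree \<open>2\<close>; comparing \<open>[S, H]\<close> with \<open>V\<close>, the Ricci scalar \<open>\<rho>\<close> has degree \<open>2\<close>
    (\<open>\<rho>_fibre_scale\<close>).

  Since \<open>V\<close> is invariant under dilations, \<open>V \<rho>\<close> has degree \<open>2\<close>.  So \<open>V \<rho> = - I\<close> equates functions of
  degrees \<open>2\<close> and \<open>0\<close>, and both vanish (\<open>main_scalar_zero\<close>).

  It remains to see that \<open>I = 0\<close> makes \<open>F\<^sup>2\<close> quadratic in \<open>y\<close> (\<open>quadratic_of_frame\<close>).  On a fixed fibre the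
  vector fields \<open>y\<close> and \<open>a\<close> now satisfy \<open>D\<^sub>y a (y) = a\<close> and \<open>D\<^sub>y a (a) = - y\<close>: the flow of \<open>a\<close> rotates the
  pair \<open>(y, a)\<close>.  Hence the four functions \<open>y\<^sub>i y\<^sub>j + a\<^sub>i a\<^sub>j\<close> (\<open>i \<le> j\<close>) and \<open>y\<^sub>1 a\<^sub>2 - y\<^sub>2 a\<^sub>1\<close> are constant along \<open>a\<close>
  and of degree \<open>2\<close>, exactly like \<open>F\<^sup>2\<close>, and because \<open>y\<close> and \<open>a\<close> span the plane they are constant multiples
  \<open>N\<^sub>i\<^sub>j F\<^sup>2\<close> and \<open>k F\<^sup>2\<close> of it.  Expanding the square of the determinant expresses \<open>k\<^sup>2 F\<^sup>4\<close> as \<open>F\<^sup>2\<close> times a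
  quadratic form in \<open>y\<close> whose matrix has the entries \<open>\<plusminus> N\<^sub>i\<^sub>j\<close>.
\<close>

section \<open>Linear algebra of the plane\<close>

lemma span_pair_2:
  fixes v w h :: "real^2"
  assumes "v $ 1 * w $ 2 - v $ 2 * w $ 1 \<noteq> 0"
  obtains r s where "h = r *\<^sub>R v + s *\<^sub>R w"
proof
  let ?d = "v $ 1 * w $ 2 - v $ 2 * w $ 1"
  have "?d *\<^sub>R h = (h $ 1 * w $ 2 - h $ 2 * w $ 1) *\<^sub>R v + (v $ 1 * h $ 2 - v $ 2 * h $ 1) *\<^sub>R w"
    by (simp add: vec_eq_iff forall_2 algebra_simps)
  then have "(1 / ?d) *\<^sub>R (?d *\<^sub>R h) = (1 / ?d) *\<^sub>R
      ((h $ 1 * w $ 2 - h $ 2 * w $ 1) *\<^sub>R v + (v $ 1 * h $ 2 - v $ 2 * h $ 1) *\<^sub>R w)"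
    by (rule arg_cong)
  then show "h = ((h $ 1 * w $ 2 - h $ 2 * w $ 1) / ?d) *\<^sub>R v + ((v $ 1 * h $ 2 - v $ 2 * h $ 1) / ?d) *\<^sub>R w"
    using assms by (simp add: scaleR_add_right)
qed

lemma parallel_2:
  fixes v w :: "real^2"
  assumes "v \<noteq> 0" "v $ 1 * w $ 2 - v $ 2 * w $ 1 = 0"
  obtains r where "w = r *\<^sub>R v"
proof (cases "v $ 1 = 0")
  case True
  then have "v $ 2 \<noteq> 0" using assms(1) by (simp add: vec_eq_iff forall_2)
  with True assms(2) show ?thesis
    by (intro that[of "w $ 2 / v $ 2"]) (simp add: vec_eq_iff forall_2)
next
  case False
  with assms(2) show ?thesis
    by (intro that[of "w $ 1 / v $ 1"]) (simp add: vec_eq_iff forall_2 field_simps)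
qed

lemma independent_2_coeffs:
  fixes v w :: "real^2"
  assumes "v $ 1 * w $ 2 - v $ 2 * w $ 1 \<noteq> 0" and 0: "r *\<^sub>R v + s *\<^sub>R w = 0"
  shows "r = 0 \<and> s = 0"
proof -
  have e: "r * v $ 1 + s * w $ 1 = 0" "r * v $ 2 + s * w $ 2 = 0"
    using arg_cong[OF 0, of "\<lambda>u. u $ 1"] arg_cong[OF 0, of "\<lambda>u. u $ 2"] by simp_all
  have "r * (v $ 1 * w $ 2 - v $ 2 * w $ 1)
      = (r * v $ 1 + s * w $ 1) * w $ 2 - (r * v $ 2 + s * w $ 2) * w $ 1"
    "s * (v $ 1 * w $ 2 - v $ 2 * w $ 1)
      = (r * v $ 2 + s * w $ 2) * v $ 1 - (r * v $ 1 + s * w $ 1) * v $ 2"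
    by (simp_all add: algebra_simps)
  then have "r * (v $ 1 * w $ 2 - v $ 2 * w $ 1) = 0" "s * (v $ 1 * w $ 2 - v $ 2 * w $ 1) = 0"
    unfolding e by simp_all
  then show ?thesis using assms(1) by simp
qed

lemma invertible_if_rank_2:
  fixes M :: "real^2^2"
  shows "rank M = 2 \<Longrightarrow> invertible M"
  using full_rank_injective[of M]
  by (simp add: invertible_left_inverse matrix_left_invertible_injective)

lemma det_nonzero_if_rank_2:
  fixes M :: "real^2^2"
  assumes "rank M = 2"
  shows "M $ 1 $ 1 * M $ 2 $ 2 - M $ 1 $ 2 * M $ 2 $ 1 \<noteq> 0"
  using invertible_if_rank_2[OF assms] by (simp add: invertible_det_nz det_2)

text \<open>
  Solving a linear system in the plane by Cramer's rule: the closed formula shows that the solution depends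
  differentiably on the matrix, which the choice operator in \<^const>\<open>matrix_inv\<close> hides.
\<close>

lemma matrix_inv_mult_2:
  fixes M :: "real^2^2" and b :: "real^2"
  assumes "rank M = 2"
  shows "matrix_inv M *v b =
    (1 / (M $ 1 $ 1 * M $ 2 $ 2 - M $ 1 $ 2 * M $ 2 $ 1)) *\<^sub>R
      vector [M $ 2 $ 2 * b $ 1 - M $ 1 $ 2 * b $ 2, M $ 1 $ 1 * b $ 2 - M $ 2 $ 1 * b $ 1]"
proof -
  have inv: "invertible M" using assms by (rule invertible_if_rank_2)
  then have "det M \<noteq> 0" by (simp add: invertible_det_nz)
  moreover have "M *v (matrix_inv M *v b) = b"
  proof -
    have "M ** matrix_inv M = mat 1"
      using someI_ex[OF inv[unfolded invertible_def]] by (simp add: matrix_inv_def)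
    then show ?thesis by (simp add: matrix_vector_mul_assoc)
  qed
  ultimately have "matrix_inv M *v b = (\<chi> k. det (\<chi> i j. if j = k then b $ i else M $ i $ j) / det M)"
    by (simp add: cramer)
  then show ?thesis
    by (simp add: vec_eq_iff forall_2 det_2 mult.commute)
qed

section \<open>Smooth functions\<close>

lemma Ck_on_cong:
  assumes "open U" "\<And>x. x \<in> U \<Longrightarrow> f x = g x"
  shows "Ck_on k U f \<longleftrightarrow> Ck_on k U g"
  using assms(2)
proof (induction k arbitrary: f g)
  case 0
  then show ?case unfolding Ck_on.simps by (intro continuous_on_cong refl)
next
  case (Suc k)
  have step: "Ck_on (Suc k) U q" if "Ck_on (Suc k) U p" and eq: "\<And>x. x \<in> U \<Longrightarrow> p x = q x"
    for p q :: "'a \<Rightarrow> 'b"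
  proof -
    have p: "\<And>x. x \<in> U \<Longrightarrow> p differentiable (at x)" using that by simp
    have q: "q differentiable (at x)" if "x \<in> U" for x
    proof -
      obtain D where "(p has_derivative D) (at x)" using p[OF \<open>x \<in> U\<close>] by (auto simp: differentiable_def)
      then have "(q has_derivative D) (at x)"
        using \<open>open U\<close> \<open>x \<in> U\<close> eq by (rule has_derivative_transform_within_open)
      then show ?thesis by (auto simp: differentiable_def)
    qed
    have "frechet_derivative p (at x) = frechet_derivative q (at x)" if "x \<in> U" for x
      using p[OF that] \<open>open U\<close> that eq by (rule frechet_derivative_transform_within_open)
    then have "Ck_on k U (\<lambda>x. frechet_derivative p (at x) v)
        \<longleftrightarrow> Ck_on k U (\<lambda>x. frechet_derivative q (at x) v)" for v
      by (intro Suc.IH) simp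
    with that q show ?thesis by simp
  qed
  show ?case
    by (rule iffI; rule step) (assumption, simp add: Suc.prems)+
qed

lemma Ck_on_Suc_imp_Ck_on: "Ck_on (Suc k) U f \<Longrightarrow> Ck_on k U f"
proof (induction k arbitrary: f)
  case 0
  then show ?case
    by (auto intro!: continuous_at_imp_continuous_on differentiable_imp_continuous_within)
next
  case (Suc k)
  show ?case
    unfolding Ck_on.simps(2)[of k U f]
    using Suc.prems Suc.IH by (subst (asm) Ck_on.simps(2)) blast
qed

lemma Ck_on_add:
  assumes "open U" "Ck_on k U f" "Ck_on k U g"
  shows "Ck_on k U (\<lambda>x. f x + g x)"
  using assms(2,3)
proof (induction k arbitrary: f g)
  case 0
  then show ?case by (simp add: continuous_on_add)
next
  case (Suc k)
  have D: "((\<lambda>x. f x + g x) has_derivative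
      (\<lambda>v. frechet_derivative f (at x) v + frechet_derivative g (at x) v)) (at x)" if "x \<in> U" for x
    using Suc.prems that by (intro has_derivative_add) (auto simp: frechet_derivative_works)
  have "Ck_on k U (\<lambda>x. frechet_derivative (\<lambda>x. f x + g x) (at x) v)" for v
  proof -
    have "Ck_on k U (\<lambda>x. frechet_derivative f (at x) v + frechet_derivative g (at x) v)"
      using Suc by simp
    then show ?thesis
      by (subst Ck_on_cong[OF \<open>open U\<close>]) (auto simp: frechet_derivative_at[OF D, symmetric])
  qed
  with D show ?case by (auto simp: differentiable_def)
qed

lemma Ck_on_mult:
  fixes f g :: "'a::real_normed_vector \<Rightarrow> real"
  assumes "open U" "Ck_on k U f" "Ck_on k U g"
  shows "Ck_on k U (\<lambda>x. f x * g x)"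
  using assms(2,3)
proof (induction k arbitrary: f g)
  case 0
  then show ?case by (simp add: continuous_on_mult)
next
  case (Suc k)
  have D: "((\<lambda>x. f x * g x) has_derivative
      (\<lambda>v. f x * frechet_derivative g (at x) v + frechet_derivative f (at x) v * g x)) (at x)"
    if "x \<in> U" for x
    using Suc.prems that by (intro has_derivative_mult) (auto simp: frechet_derivative_works)
  have "Ck_on k U (\<lambda>x. frechet_derivative (\<lambda>x. f x * g x) (at x) v)" for v
  proof -
    have "Ck_on k U f" "Ck_on k U g" using Suc.prems by (auto intro: Ck_on_Suc_imp_Ck_on)
    then have "Ck_on k U (\<lambda>x. f x * frechet_derivative g (at x) v + frechet_derivative f (at x) v * g x)"
      using Suc by (intro Ck_on_add[OF \<open>open U\<close>]) auto
    then show ?thesis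
      by (subst Ck_on_cong[OF \<open>open U\<close>]) (auto simp: frechet_derivative_at[OF D, symmetric])
  qed
  with D show ?case by (auto simp: differentiable_def)
qed

lemma smooth_on_mult:
  fixes f g :: "'a::real_normed_vector \<Rightarrow> real"
  shows "open U \<Longrightarrow> smooth_on U f \<Longrightarrow> smooth_on U g \<Longrightarrow> smooth_on U (\<lambda>x. f x * g x)"
  by (simp add: smooth_on_def Ck_on_mult)

lemma smooth_on_imp_differentiable:
  assumes "smooth_on U f" "x \<in> U"
  shows "f differentiable (at x)"
proof -
  have "Ck_on (Suc 0) U f" using assms(1) unfolding smooth_on_def by blast
  with assms(2) show ?thesis by simp
qed

lemma smooth_on_frechet_derivative:
  assumes "smooth_on U f"
  shows "smooth_on U (\<lambda>x. frechet_derivative f (at x) v)"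
  unfolding smooth_on_def
proof
  fix k
  have "Ck_on (Suc k) U f" using assms unfolding smooth_on_def by blast
  then show "Ck_on k U (\<lambda>x. frechet_derivative f (at x) v)" unfolding Ck_on.simps by blast
qed

lemma smooth_on_dx: "smooth_on U f \<Longrightarrow> smooth_on U (dx i f)"
  and smooth_on_dy: "smooth_on U f \<Longrightarrow> smooth_on U (dy i f)"
  unfolding dx_def[abs_def] dy_def[abs_def] by (auto intro: smooth_on_frechet_derivative)

lemma differentiable_vec_nth_iff:
  fixes f :: "'a::real_normed_vector \<Rightarrow> real^'n"
  shows "f differentiable (at x) \<longleftrightarrow> (\<forall>i. (\<lambda>x. f x $ i) differentiable (at x))"
proof
  assume "f differentiable (at x)"
  then obtain f' where "(f has_derivative f') (at x)" by (auto simp: differentiable_def)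
  then have "((\<lambda>x. f x $ i) has_derivative (\<lambda>h. f' h $ i)) (at x)" for i
    by (rule bounded_linear.has_derivative[OF bounded_linear_vec_nth])
  then show "\<forall>i. (\<lambda>x. f x $ i) differentiable (at x)" unfolding differentiable_def by blast
next
  assume "\<forall>i. (\<lambda>x. f x $ i) differentiable (at x)"
  then have "(\<lambda>x. \<Sum>i\<in>UNIV. f x $ i *\<^sub>R axis i (1::real)) differentiable (at x)"
    by (intro differentiable_sum differentiable_scaleR) auto
  moreover have "(\<lambda>x. \<Sum>i\<in>UNIV. f x $ i *\<^sub>R axis i (1::real)) = f"
    using basis_expansion[where 'a = real and 'n = 'n] by (simp add: fun_eq_iff scalar_mult_eq_scaleR)
  ultimately show "f differentiable (at x)" by (simp only:)
qed

section \<open>Homogeneity along the fibres\<close>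

text \<open>
  Euler's criterion: along the ray \<open>s \<mapsto> (x, s y)\<close> the function \<open>s\<^sup>-\<^sup>k f (x, s y)\<close> has derivative zero.
\<close>

lemma euler_homogeneous:
  fixes f :: "'a::real_normed_vector \<times> 'b::real_normed_vector \<Rightarrow> 'c::real_normed_vector"
  assumes diff: "\<And>y. y \<noteq> 0 \<Longrightarrow> f differentiable (at (x, y))"
    and euler: "\<And>y. y \<noteq> 0 \<Longrightarrow> frechet_derivative f (at (x, y)) (0, y) = real k *\<^sub>R f (x, y)"
    and "y \<noteq> 0" "t > 0"
  shows "f (x, t *\<^sub>R y) = t ^ k *\<^sub>R f (x, y)"
proof -
  define u where "u s = inverse (s ^ k) *\<^sub>R f (x, s *\<^sub>R y)" for s
  have "(u has_derivative (\<lambda>h. 0)) (at s)" if "s > 0" for s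
  proof -
    let ?D = "frechet_derivative f (at (x, s *\<^sub>R y))"
    have ne: "s *\<^sub>R y \<noteq> 0" using that \<open>y \<noteq> 0\<close> by simp
    have F: "(f has_derivative ?D) (at (x, s *\<^sub>R y))"
      using diff[OF ne] by (simp add: frechet_derivative_works)
    then have lin: "linear ?D" by (rule has_derivative_linear)
    have c: "((\<lambda>s. (x, s *\<^sub>R y)) has_derivative (\<lambda>h. (0, h *\<^sub>R y))) (at s)"
      by (auto intro!: derivative_eq_intros)
    have "((\<lambda>s. f (x, s *\<^sub>R y)) has_derivative (\<lambda>h. ?D (0, h *\<^sub>R y))) (at s)"
      using has_derivative_compose[OF c F] by simp
    moreover have "?D (0, h *\<^sub>R y) = (h * real k / s) *\<^sub>R f (x, s *\<^sub>R y)" for h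
    proof -
      have "?D (0, h *\<^sub>R y) = ?D ((h / s) *\<^sub>R (0, s *\<^sub>R y))" using that by simp
      also have "\<dots> = (h / s) *\<^sub>R ?D (0, s *\<^sub>R y)" using lin by (rule linear_scale)
      also have "\<dots> = (h * real k / s) *\<^sub>R f (x, s *\<^sub>R y)" using euler[OF ne] by simp
      finally show ?thesis .
    qed
    ultimately have f: "((\<lambda>s. f (x, s *\<^sub>R y)) has_derivative
        (\<lambda>h. (h * real k / s) *\<^sub>R f (x, s *\<^sub>R y))) (at s)" by simp
    have p: "((\<lambda>s. inverse (s ^ k)) has_derivative (\<lambda>h. - (real k * h / s) * inverse (s ^ k))) (at s)"
    proof -
      have "((\<lambda>s. s ^ k) has_derivative (\<lambda>h. real k * h / s * s ^ k)) (at s)"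
        using that
        by (intro has_derivative_eq_rhs[OF has_derivative_power[OF has_derivative_ident]])
           (cases k; simp add: fun_eq_iff)
      then have "((\<lambda>s. inverse (s ^ k)) has_derivative
          (\<lambda>h. - (inverse (s ^ k) * (real k * h / s * s ^ k) * inverse (s ^ k)))) (at s)"
        by (rule Deriv.has_derivative_inverse[rotated]) (use that in simp)
      moreover have "(\<lambda>h. - (inverse (s ^ k) * (real k * h / s * s ^ k) * inverse (s ^ k)))
          = (\<lambda>h. - (real k * h / s) * inverse (s ^ k))"
        using that by (auto simp: fun_eq_iff)
      ultimately show ?thesis by (simp only:)
    qed
    show ?thesis
      unfolding u_def
      by (rule has_derivative_eq_rhs, rule has_derivative_scaleR[OF p f])
         (auto simp: fun_eq_iff algebra_simps simp flip: scaleR_add_left)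
  qed
  then have "u t = u 1"
    using \<open>t > 0\<close> by (intro has_derivative_zero_unique_connected[of "{0<..}"]) auto
  moreover have "t ^ k *\<^sub>R u t = f (x, t *\<^sub>R y)" "u 1 = f (x, y)"
    using \<open>t > 0\<close> by (simp_all add: u_def)
  ultimately show ?thesis by metis
qed

text \<open>
  A function intertwining two linear maps has a derivative intertwining them, by the chain rule on both
  sides of \<open>f \<circ> m = n \<circ> f\<close>.  With \<open>m\<close> a fibre dilation this says that derivatives of homogeneous functions are
  homogeneous.
\<close>

lemma frechet_derivative_equivariant:
  assumes "open U" "z \<in> U" "m z \<in> U" and m: "bounded_linear m" and n: "bounded_linear n"
    and eq: "\<And>w. w \<in> U \<Longrightarrow> f (m w) = n (f w)"
    and diff: "\<And>w. w \<in> U \<Longrightarrow> f differentiable (at w)"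
  shows "frechet_derivative f (at (m z)) (m h) = n (frechet_derivative f (at z) h)"
proof -
  have fz: "(f has_derivative frechet_derivative f (at z)) (at z)"
    and fmz: "(f has_derivative frechet_derivative f (at (m z))) (at (m z))"
    using diff \<open>z \<in> U\<close> \<open>m z \<in> U\<close> by (auto simp: frechet_derivative_works)
  have "((\<lambda>w. f (m w)) has_derivative (\<lambda>h. frechet_derivative f (at (m z)) (m h))) (at z)"
    using bounded_linear_imp_has_derivative[OF m] fmz by (rule has_derivative_compose)
  moreover have "((\<lambda>w. f (m w)) has_derivative (\<lambda>h. n (frechet_derivative f (at z) h))) (at z)"
    by (rule has_derivative_transform_within_open[OF bounded_linear.has_derivative[OF n fz] \<open>open U\<close> \<open>z \<in> U\<close>])
       (simp add: eq)
  ultimately show ?thesis using has_derivative_unique by metis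
qed

definition fibre_scale :: "real \<Rightarrow> 'a \<times> 'b \<Rightarrow> 'a \<times> 'b::real_vector" where
  "fibre_scale t w = (fst w, t *\<^sub>R snd w)"

lemma fst_fibre_scale [simp]: "fst (fibre_scale t w) = fst w"
  and snd_fibre_scale [simp]: "snd (fibre_scale t w) = t *\<^sub>R snd w"
  and fibre_scale_Pair: "fibre_scale t (p, q) = (p, t *\<^sub>R q)"
  by (simp_all add: fibre_scale_def)

lemma bounded_linear_fibre_scale:
  "bounded_linear (fibre_scale t :: 'a::real_normed_vector \<times> 'b::real_normed_vector \<Rightarrow> _)"
  unfolding fibre_scale_def[abs_def]
  by (intro bounded_linear_Pair bounded_linear_scaleR_right[THEN bounded_linear_compose]
      bounded_linear_fst bounded_linear_snd)

lemma bounded_linear_scaled_fibre_scale: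
  "bounded_linear (\<lambda>w :: 'a::real_normed_vector \<times> 'b::real_normed_vector. t *\<^sub>R fibre_scale t w)"
  by (intro bounded_linear_scaleR_right[THEN bounded_linear_compose] bounded_linear_fibre_scale)

section \<open>Induced coordinates on the tangent bundle\<close>

lemma open_image_chart:
  assumes "smooth_atlas A" "c \<in> A" "open T" "T \<subseteq> fst c"
  shows "open (snd c ` T)"
proof -
  have "homeomorphism (fst c) (chart_image c) (snd c) (chart_inv c)" and "open (chart_image c)" and "open (fst c)"
    using assms by (auto simp: smooth_atlas_def)
  moreover have "openin (top_of_set (fst c)) T"
    using assms calculation by (simp add: openin_open_eq)
  ultimately show ?thesis
    by (metis homeomorphism_imp_open_map openin_open_eq)
qed

lemma chart_inv_chart:
  assumes "smooth_atlas A" "c \<in> A" "p \<in> fst c"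
  shows "chart_inv c (snd c p) = p"
  using assms by (auto simp: smooth_atlas_def homeomorphism_def)

lemma transition_differentiable:
  assumes "smooth_atlas A" "c \<in> A" "d \<in> A" "p \<in> fst c" "p \<in> fst d"
  shows "transition c d differentiable (at (snd c p))"
  using assms by (intro smooth_on_imp_differentiable[of "snd c ` (fst c \<inter> fst d)"])
    (auto simp: smooth_atlas_def)

text \<open>
  The cocycle property of the differentials of the transition maps.  It makes the family of components
  obtained by transporting one vector of \<open>\<real>\<^sup>2\<close> from a single chart to all others a tangent vector, which is
  what surjectivity of the induced coordinates rests on.
\<close>

lemma frechet_derivative_transition_trans:
  assumes "smooth_atlas A" "c \<in> A" "d \<in> A" "e \<in> A" "p \<in> fst c" "p \<in> fst d" "p \<in> fst e"
  shows "frechet_derivative (transition d e) (at (snd d p)) (frechet_derivative (transition c d) (at (snd c p)) v)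
    = frechet_derivative (transition c e) (at (snd c p)) v"
proof -
  let ?T = "fst c \<inter> fst d \<inter> fst e"
  have opn: "open (snd c ` ?T)"
    using assms by (intro open_image_chart) (auto simp: smooth_atlas_def)
  have cd: "(transition c d has_derivative frechet_derivative (transition c d) (at (snd c p))) (at (snd c p))"
    using transition_differentiable[of A c d p] assms by (simp add: frechet_derivative_works)
  have eq: "transition c d (snd c p) = snd d p"
    using assms by (simp add: transition_def chart_inv_chart[of A])
  have de: "(transition d e has_derivative frechet_derivative (transition d e) (at (snd d p)))
      (at (transition c d (snd c p)))"
    unfolding eq using transition_differentiable[of A d e p] assms by (simp add: frechet_derivative_works)
  have "((\<lambda>x. transition d e (transition c d x)) has_derivative
      (\<lambda>v. frechet_derivative (transition d e) (at (snd d p)) (frechet_derivative (transition c d) (at (snd c p)) v)))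
      (at (snd c p))"
    by (rule has_derivative_compose[OF cd de])
  then have "(transition c e has_derivative
      (\<lambda>v. frechet_derivative (transition d e) (at (snd d p)) (frechet_derivative (transition c d) (at (snd c p)) v)))
      (at (snd c p))"
    by (rule has_derivative_transform_within_open[OF _ opn])
       (use assms in \<open>auto simp: transition_def chart_inv_chart[of A]\<close>)
  from frechet_derivative_at[OF this] show ?thesis by metis
qed

lemma frechet_derivative_transition_self:
  assumes "smooth_atlas A" "c \<in> A" "p \<in> fst c"
  shows "frechet_derivative (transition c c) (at (snd c p)) v = v"
proof -
  have "(transition c c has_derivative (\<lambda>v. v)) (at (snd c p))"
    by (rule has_derivative_transform_within_open[OF has_derivative_ident, of "chart_image c"])
       (use assms in \<open>auto simp: transition_def chart_inv_chart[of A] smooth_atlas_def\<close>)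
  from frechet_derivative_at[OF this] show ?thesis by metis
qed

lemma linear_frechet_transition:
  assumes "smooth_atlas A" "c \<in> A" "d \<in> A" "p \<in> fst c" "p \<in> fst d"
  shows "linear (frechet_derivative (transition c d) (at (snd c p)))"
  using transition_differentiable[OF assms] by (simp add: frechet_derivative_works has_derivative_linear)

lemma tangent_bundle_component:
  assumes "(p, \<xi>) \<in> tangent_bundle A" "c \<in> A" "d \<in> A" "p \<in> fst c" "p \<in> fst d"
  shows "\<xi> d = frechet_derivative (transition c d) (at (snd c p)) (\<xi> c)"
  using assms unfolding tangent_bundle_def by blast

lemma tangent_bundle_component_outside:
  assumes "(p, \<xi>) \<in> tangent_bundle A" "\<not> (c \<in> A \<and> p \<in> fst c)"
  shows "\<xi> c = 0"
  using assms unfolding tangent_bundle_def by blast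

lemma tcoord_surj:
  assumes "smooth_atlas A" "c \<in> A" "x \<in> chart_image c"
  shows "(x, y) \<in> tcoord c ` {u \<in> tangent_bundle A. fst u \<in> fst c}"
proof -
  obtain p where p: "p \<in> fst c" "x = snd c p" using assms(3) by auto
  define \<xi> where "\<xi> d = (if d \<in> A \<and> p \<in> fst d
     then frechet_derivative (transition c d) (at (snd c p)) y else 0)" for d
  have "(p, \<xi>) \<in> tangent_bundle A"
    using assms p frechet_derivative_transition_trans[of A c _ _ p y]
    by (auto simp: tangent_bundle_def \<xi>_def)
  moreover have "\<xi> c = y"
    using assms p by (simp add: \<xi>_def frechet_derivative_transition_self)
  ultimately show ?thesis using p by (intro image_eqI[of _ _ "(p, \<xi>)"]) (auto simp: tcoord_def)
qed

lemma tcoord_inj_on: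
  assumes "smooth_atlas A" "c \<in> A"
  shows "inj_on (tcoord c) {u \<in> tangent_bundle A. fst u \<in> fst c}"
proof (rule inj_onI; clarsimp)
  fix p \<xi> q \<eta>
  assume t: "(p, \<xi>) \<in> tangent_bundle A" "(q, \<eta>) \<in> tangent_bundle A" and pq: "p \<in> fst c" "q \<in> fst c"
    and eq: "tcoord c (p, \<xi>) = tcoord c (q, \<eta>)"
  have "chart_inv c (snd c p) = chart_inv c (snd c q)" using eq by (simp add: tcoord_def)
  then have "p = q" using assms pq by (simp add: chart_inv_chart[of A])
  have "\<xi> d = \<eta> d" for d
  proof (cases "d \<in> A \<and> p \<in> fst d")
    case True
    then have "\<xi> d = frechet_derivative (transition c d) (at (snd c p)) (\<xi> c)"
      "\<eta> d = frechet_derivative (transition c d) (at (snd c q)) (\<eta> c)"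
      using t pq assms \<open>p = q\<close> by (auto intro: tangent_bundle_component)
    then show ?thesis using eq by (simp add: tcoord_def)
  next
    case False
    then have "\<xi> d = 0" "\<eta> d = 0"
      using t \<open>p = q\<close> by (auto intro: tangent_bundle_component_outside)
    then show ?thesis by simp
  qed
  with \<open>p = q\<close> show "p = q \<and> \<xi> = \<eta>" by auto
qed

lemma
  assumes "smooth_atlas A" "c \<in> A" "x \<in> chart_image c"
  shows tinv_in_tangent_bundle: "tinv A c (x, y) \<in> tangent_bundle A"
    and fst_tinv_in_chart: "fst (tinv A c (x, y)) \<in> fst c"
    and tcoord_tinv: "tcoord c (tinv A c (x, y)) = (x, y)"
  using inv_into_into[OF tcoord_surj[OF assms, of y]] f_inv_into_f[OF tcoord_surj[OF assms, of y]]
  by (auto simp: tinv_def)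

lemma tinv_tcoord:
  assumes "smooth_atlas A" "c \<in> A" "u \<in> tangent_bundle A" "fst u \<in> fst c"
  shows "tinv A c (tcoord c u) = u"
  unfolding tinv_def using assms by (intro inv_into_f_f tcoord_inj_on) auto

lemma tangent_bundle_scaleR:
  assumes "smooth_atlas A" "(p, \<xi>) \<in> tangent_bundle A"
  shows "(p, \<lambda>c. t *\<^sub>R \<xi> c) \<in> tangent_bundle A"
proof -
  have comp: "t *\<^sub>R \<xi> d = frechet_derivative (transition c d) (at (snd c p)) (t *\<^sub>R \<xi> c)"
    if "c \<in> A" "d \<in> A" "p \<in> fst c" "p \<in> fst d" for c d
    using tangent_bundle_component[OF assms(2) that]
      linear_scale[OF linear_frechet_transition[OF assms(1) that], of t "\<xi> c"] by simp
  have zero: "t *\<^sub>R \<xi> c = 0" if "c \<notin> A \<or> p \<notin> fst c" for c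
    using tangent_bundle_component_outside[OF assms(2), of c] that by simp
  show ?thesis
    unfolding tangent_bundle_def
    by (intro CollectI case_prodI conjI ballI allI impI) ((elim conjE)?, rule comp zero; assumption)+
qed

lemma tinv_scaleR:
  assumes "smooth_atlas A" "c \<in> A" "x \<in> chart_image c"
  shows "tinv A c (x, t *\<^sub>R y) = (fst (tinv A c (x, y)), \<lambda>d. t *\<^sub>R snd (tinv A c (x, y)) d)"
proof -
  obtain p \<xi> where u: "tinv A c (x, y) = (p, \<xi>)" by fastforce
  have "(p, \<lambda>d. t *\<^sub>R \<xi> d) \<in> tangent_bundle A"
    using tinv_in_tangent_bundle[OF assms, of y] u assms by (simp add: tangent_bundle_scaleR)
  moreover have "p \<in> fst c" "tcoord c (p, \<lambda>d. t *\<^sub>R \<xi> d) = (x, t *\<^sub>R y)"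
    using fst_tinv_in_chart[OF assms, of y] tcoord_tinv[OF assms, of y] u by (auto simp: tcoord_def)
  ultimately show ?thesis using tinv_tcoord[OF assms(1,2), of "(p, \<lambda>d. t *\<^sub>R \<xi> d)"] u by simp
qed

context
  fixes A :: "'a::{t2_space, second_countable_topology} chart set" and F and c and x :: "real^2"
  assumes atlas: "smooth_atlas A" and F: "finsler_function A F" and c: "c \<in> A" and x: "x \<in> chart_image c"
begin

lemma local_rep_scaleR:
  assumes "t > 0"
  shows "local_rep A F c (x, t *\<^sub>R y) = t * local_rep A F c (x, y)"
proof -
  obtain p \<xi> where u: "tinv A c (x, y) = (p, \<xi>)" by fastforce
  then have "(p, \<xi>) \<in> tangent_bundle A" using tinv_in_tangent_bundle[OF atlas c x, of y] by simp
  then have "F (p, \<lambda>d. t *\<^sub>R \<xi> d) = t * F (p, \<xi>)"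
    using F assms unfolding finsler_function_def by blast
  then show ?thesis by (simp add: local_rep_def tinv_scaleR[OF atlas c x] u)
qed

lemma local_rep_pos:
  assumes "y \<noteq> 0"
  shows "local_rep A F c (x, y) > 0"
proof -
  have "tinv A c (x, y) \<notin> zero_section"
    using tcoord_tinv[OF atlas c x, of y] assms by (auto simp: zero_section_def tcoord_def)
  then have "tinv A c (x, y) \<in> slit_bundle A"
    using tinv_in_tangent_bundle[OF atlas c x, of y] by (simp add: slit_bundle_def)
  then show ?thesis using F by (simp add: finsler_function_def local_rep_def)
qed

lemma local_rep_0: "local_rep A F c (x, 0) = 0"
proof -
  have "snd (tinv A c (x, 0)) = (\<lambda>d. 0)"
    using arg_cong[OF tinv_scaleR[OF atlas c x, of 0 0], of snd] by simp
  then have "tinv A c (x, 0) \<in> zero_section"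
    by (simp add: zero_section_def case_prod_unfold)
  then show ?thesis
    using F tinv_in_tangent_bundle[OF atlas c x, of 0] by (simp add: finsler_function_def local_rep_def)
qed

end

section \<open>Differentiability of the geodesic spray\<close>

text \<open>
  The Lie brackets with \<open>S\<close> carry information only where \<open>S\<close> is differentiable, since
  \<^const>\<open>frechet_derivative\<close> is unspecified elsewhere.  The spray coefficients are rational expressions in derivatives
  of \<open>F\<^sup>2\<close> whose denominator is the determinant of the metric, which is nonzero by maximal rank.
\<close>

lemma geodesic_spray_differentiable:
  assumes "open (slit c)" and F: "smooth_on (slit c) (local_rep A F c)"
    and rank: "\<And>z. z \<in> slit c \<Longrightarrow> rank (metric A F c z) = 2"
    and "z \<in> slit c"
  shows "geodesic_spray A F c differentiable (at z)"
proof -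
  define E where "E = (\<lambda>w. (local_rep A F c w)\<^sup>2)"
  have E: "smooth_on (slit c) E"
    unfolding E_def power2_eq_square using \<open>open (slit c)\<close> F F by (rule smooth_on_mult)
  let ?M = "metric A F c"
  define b :: "(real^2) \<times> (real^2) \<Rightarrow> real^2" where
    "b w = (\<chi> l. (\<Sum>k\<in>UNIV. snd w $ k * dx k (dy l E) w) - dx l E w)" for w
  define d where "d w = ?M w $ 1 $ 1 * ?M w $ 2 $ 2 - ?M w $ 1 $ 2 * ?M w $ 2 $ 1" for w
  define G :: "(real^2) \<times> (real^2) \<Rightarrow> real^2" where "G w = (1/4) *\<^sub>R ((1 / d w) *\<^sub>R
     vector [?M w $ 2 $ 2 * b w $ 1 - ?M w $ 1 $ 2 * b w $ 2,
             ?M w $ 1 $ 1 * b w $ 2 - ?M w $ 2 $ 1 * b w $ 1])" for w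
  have M: "(\<lambda>w. ?M w $ i $ j) differentiable (at z)" for i j
  proof -
    have "dy i (dy j E) differentiable (at z)"
      using E \<open>z \<in> slit c\<close> by (intro smooth_on_imp_differentiable[of "slit c"] smooth_on_dy)
    then have "(\<lambda>w. (1/2) * dy i (dy j E) w) differentiable (at z)"
      by (intro differentiable_mult differentiable_const)
    then show ?thesis by (simp add: metric_def E_def)
  qed
  have b: "(\<lambda>w. b w $ l) differentiable (at z)" for l
  proof -
    have "dx k (dy l E) differentiable (at z)" "dx l E differentiable (at z)" for k
      using E \<open>z \<in> slit c\<close>
      by (auto intro!: smooth_on_imp_differentiable[of "slit c"] smooth_on_dx smooth_on_dy)
    moreover have "(\<lambda>w::(real^2) \<times> (real^2). snd w $ k) differentiable (at z)" for k
      by (intro bounded_linear_imp_differentiable bounded_linear_compose[OF bounded_linear_vec_nth]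
          bounded_linear_snd)
    ultimately have "(\<lambda>w. (\<Sum>k\<in>UNIV. snd w $ k * dx k (dy l E) w) - dx l E w) differentiable (at z)"
      by (intro differentiable_diff differentiable_sum differentiable_mult finite_UNIV ballI) auto
    then show ?thesis by (simp add: b_def)
  qed
  have "d z \<noteq> 0" using det_nonzero_if_rank_2[OF rank[OF \<open>z \<in> slit c\<close>]] by (simp add: d_def)
  moreover have "d differentiable (at z)"
    unfolding d_def[abs_def] by (intro differentiable_diff differentiable_mult M)
  ultimately have "G differentiable (at z)"
    unfolding G_def[abs_def] differentiable_vec_nth_iff forall_2
    by (simp add: M b)
  then obtain G' where G': "(G has_derivative G') (at z)" by (auto simp: differentiable_def)
  define D where "D h = (snd h, - (2 *\<^sub>R G' h))" for h
  have D: "((\<lambda>w. (snd w, - (2 *\<^sub>R G w))) has_derivative D) (at z)"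
    unfolding D_def[abs_def]
    by (intro has_derivative_Pair has_derivative_snd has_derivative_ident has_derivative_minus
        has_derivative_scaleR_right G')
  have "(geodesic_spray A F c has_derivative D) (at z)"
  proof (rule has_derivative_transform_within_open[OF D \<open>open (slit c)\<close> \<open>z \<in> slit c\<close>])
    fix w assume "w \<in> slit c"
    have "spray_coeff A F c w = G w"
      unfolding spray_coeff_def Let_def E_def[symmetric] b_def[symmetric] G_def d_def
      by (simp only: matrix_inv_mult_2[OF rank[OF \<open>w \<in> slit c\<close>]])
    then show "(snd w, - (2 *\<^sub>R G w)) = geodesic_spray A F c w"
      by (simp add: geodesic_spray_def)
  qed
  then show ?thesis by (auto simp: differentiable_def)
qed

section \<open>Fibrewise frames with vanishing main scalar\<close>

text \<open>
  The equations for \<open>\<alpha>\<close> say that \<open>y\<close> and \<open>\<alpha> y\<close> rotate into each other along \<open>\<alpha>\<close>, so the level sets of \<open>\<phi>\<close> are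
  ellipses with conjugate semi-diameters \<open>y\<close> and \<open>\<alpha> y\<close>.  The proof uses first integrals instead of the flow:
  the entries of the Gram-type matrix \<open>y y\<^sup>T + \<alpha> \<alpha>\<^sup>T\<close> and the determinant of \<open>(y, \<alpha>)\<close> are all proportional to \<open>\<phi>\<close>.
\<close>

lemma quadratic_of_frame:
  fixes \<alpha> :: "real^2 \<Rightarrow> real^2" and \<phi> :: "real^2 \<Rightarrow> real"
  assumes \<alpha>: "\<And>y. y \<noteq> 0 \<Longrightarrow> (\<alpha> has_derivative \<alpha>' y) (at y)"
    and \<alpha>y: "\<And>y. y \<noteq> 0 \<Longrightarrow> \<alpha>' y y = \<alpha> y" and \<alpha>\<alpha>: "\<And>y. y \<noteq> 0 \<Longrightarrow> \<alpha>' y (\<alpha> y) = - y"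
    and indep: "\<And>y. y \<noteq> 0 \<Longrightarrow> y $ 1 * \<alpha> y $ 2 - y $ 2 * \<alpha> y $ 1 \<noteq> 0"
    and \<phi>: "\<And>y. y \<noteq> 0 \<Longrightarrow> (\<phi> has_derivative \<phi>' y) (at y)"
    and \<phi>y: "\<And>y. y \<noteq> 0 \<Longrightarrow> \<phi>' y y = 2 * \<phi> y" and \<phi>\<alpha>: "\<And>y. y \<noteq> 0 \<Longrightarrow> \<phi>' y (\<alpha> y) = 0"
    and pos: "\<And>y. y \<noteq> 0 \<Longrightarrow> \<phi> y > 0"
  obtains a :: "real^2^2" where
    "\<And>y. y \<noteq> 0 \<Longrightarrow> \<phi> y = (\<Sum>i\<in>UNIV. \<Sum>j\<in>UNIV. a $ i $ j * y $ i * y $ j)"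
proof -
  \<comment> \<open>A function of degree \<open>2\<close> that is constant along \<open>\<alpha>\<close> is a multiple of \<open>\<phi>\<close>: the quotient has zero
    derivative in the two spanning directions \<open>y\<close> and \<open>\<alpha> y\<close>, and the punctured plane is connected.\<close>
  have proportional: "\<exists>c. \<forall>y. y \<noteq> 0 \<longrightarrow> u y = c * \<phi> y"
    if u: "\<And>y. y \<noteq> 0 \<Longrightarrow> (u has_derivative u' y) (at y)"
      and uy: "\<And>y. y \<noteq> 0 \<Longrightarrow> u' y y = 2 * u y"
      and u\<alpha>: "\<And>y. y \<noteq> 0 \<Longrightarrow> u' y (\<alpha> y) = 0" for u u'
  proof -
    define q where "q y = u y / \<phi> y" for y
    have "(q has_derivative (\<lambda>h. 0)) (at y)" if "y \<noteq> 0" for y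
    proof -
      define Q where
        "Q = (\<lambda>h. - u y * (inverse (\<phi> y) * \<phi>' y h * inverse (\<phi> y)) + u' y h / \<phi> y)"
      have D: "(q has_derivative Q) (at y)"
        unfolding q_def Q_def using pos[OF that] by (intro has_derivative_divide u \<phi> that) simp
      then have lin: "linear Q" by (rule has_derivative_linear)
      have Q0: "Q y = 0" "Q (\<alpha> y) = 0"
        using pos[OF that] uy[OF that] \<phi>y[OF that] u\<alpha>[OF that] \<phi>\<alpha>[OF that]
        by (simp_all add: Q_def field_simps)
      have "Q h = 0" for h
      proof -
        obtain r s where h: "h = r *\<^sub>R y + s *\<^sub>R \<alpha> y"
          using indep[OF \<open>y \<noteq> 0\<close>] by (rule span_pair_2)
        show ?thesis
          unfolding h by (simp add: linear_add[OF lin] linear_scale[OF lin] Q0)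
      qed
      then have "Q = (\<lambda>h. 0)" by (rule ext)
      with D show ?thesis by (simp only:)
    qed
    moreover have "connected (- {0::real^2})" by (rule connected_punctured_universe) simp
    ultimately have q: "q y = q (axis 1 1)" if "y \<noteq> 0" for y
      using that by (intro has_derivative_zero_unique_connected[of "- {0}"]) auto
    have "u y = q (axis 1 1) * \<phi> y" if "y \<noteq> 0" for y
    proof -
      have "u y = q y * \<phi> y" using pos[OF that] by (simp add: q_def)
      then show ?thesis by (simp only: q[OF that])
    qed
    then show ?thesis by blast
  qed
  have comp: "((\<lambda>y. \<alpha> y $ i) has_derivative (\<lambda>h. \<alpha>' y h $ i)) (at y)" if "y \<noteq> 0" for y i
    using \<alpha>[OF that] by (rule bounded_linear.has_derivative[OF bounded_linear_vec_nth])
  have coord: "((\<lambda>y. y $ i) has_derivative (\<lambda>h. h $ i)) (at y)" for y :: "real^2" and i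
    by (rule bounded_linear_imp_has_derivative) (rule bounded_linear_vec_nth)
  have "\<exists>c. \<forall>y. y \<noteq> 0 \<longrightarrow> y $ i * y $ j + \<alpha> y $ i * \<alpha> y $ j = c * \<phi> y" for i j
    by (rule proportional[where u' = "\<lambda>y h. (y $ i * h $ j + h $ i * y $ j)
          + (\<alpha> y $ i * \<alpha>' y h $ j + \<alpha>' y h $ i * \<alpha> y $ j)"])
       (auto intro!: has_derivative_add has_derivative_mult comp coord simp: \<alpha>y \<alpha>\<alpha>)
  then obtain N where N: "\<And>i j y. y \<noteq> 0 \<Longrightarrow> y $ i * y $ j + \<alpha> y $ i * \<alpha> y $ j = N i j * \<phi> y"
    by metis
  have "\<exists>c. \<forall>y. y \<noteq> 0 \<longrightarrow> y $ 1 * \<alpha> y $ 2 - y $ 2 * \<alpha> y $ 1 = c * \<phi> y"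
    by (rule proportional[where u' = "\<lambda>y h. (y $ 1 * \<alpha>' y h $ 2 + h $ 1 * \<alpha> y $ 2)
          - (y $ 2 * \<alpha>' y h $ 1 + h $ 2 * \<alpha> y $ 1)"])
       (auto intro!: has_derivative_diff has_derivative_mult comp coord simp: \<alpha>y \<alpha>\<alpha>)
  then obtain k where k: "\<And>y. y \<noteq> 0 \<Longrightarrow> y $ 1 * \<alpha> y $ 2 - y $ 2 * \<alpha> y $ 1 = k * \<phi> y"
    by metis
  have "k \<noteq> 0"
    using indep[of "axis 1 1"] k[of "axis 1 1"] by auto
  \<comment> \<open>The matrix is the adjugate of \<open>N\<close> divided by \<open>k\<^sup>2\<close>.\<close>
  define a :: "real^2^2" where "a = vector [vector [N 2 2 / k\<^sup>2, - N 1 2 / k\<^sup>2], vector [- N 1 2 / k\<^sup>2, N 1 1 / k\<^sup>2]]"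
  show thesis
  proof (rule that[of a])
    fix y :: "real^2" assume "y \<noteq> 0"
    have "(k * \<phi> y)\<^sup>2 = (y $ 1 * \<alpha> y $ 2 - y $ 2 * \<alpha> y $ 1)\<^sup>2" using k \<open>y \<noteq> 0\<close> by simp
    also have "\<dots> = (y $ 2 * y $ 2 + \<alpha> y $ 2 * \<alpha> y $ 2) * (y $ 1)\<^sup>2
        - 2 * (y $ 1 * y $ 2 + \<alpha> y $ 1 * \<alpha> y $ 2) * y $ 1 * y $ 2
        + (y $ 1 * y $ 1 + \<alpha> y $ 1 * \<alpha> y $ 1) * (y $ 2)\<^sup>2"
      by (simp add: power2_eq_square algebra_simps)
    also have "\<dots> = (N 2 2 * (y $ 1)\<^sup>2 - 2 * N 1 2 * y $ 1 * y $ 2 + N 1 1 * (y $ 2)\<^sup>2) * \<phi> y"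
      unfolding N[OF \<open>y \<noteq> 0\<close>] by (simp add: algebra_simps)
    finally have "k\<^sup>2 * \<phi> y = N 2 2 * (y $ 1)\<^sup>2 - 2 * N 1 2 * y $ 1 * y $ 2 + N 1 1 * (y $ 2)\<^sup>2"
      using pos[OF \<open>y \<noteq> 0\<close>] by (simp add: power2_eq_square)
    then have "\<phi> y = (N 2 2 * (y $ 1)\<^sup>2 - 2 * N 1 2 * y $ 1 * y $ 2 + N 1 1 * (y $ 2)\<^sup>2) / k\<^sup>2"
      using \<open>k \<noteq> 0\<close> by (simp add: nonzero_eq_divide_eq mult.commute)
    then show "\<phi> y = (\<Sum>i\<in>UNIV. \<Sum>j\<in>UNIV. a $ i $ j * y $ i * y $ j)"
      by (simp add: a_def sum_2 power2_eq_square diff_divide_distrib add_divide_distrib mult_ac)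
  qed
qed

section \<open>The Berwald frame in a chart\<close>

text \<open>
  The coordinate expressions of a Finsler function \<open>f\<close>, its spray \<open>S\<close>, the Ricci scalar \<open>\<rho>\<close> and the vector field
  \<open>H\<close> of the Berwald frame on a chart with image \<open>X\<close>, together with those structure equations that determine the
  degrees of homogeneity.  The vertical field \<open>V\<close> is the tangent structure applied to \<open>H\<close>.
\<close>

locale berwald_chart =
  fixes X :: "(real^2) set" and f \<rho> I J :: "(real^2) \<times> (real^2) \<Rightarrow> real" and S H :: local_field
  assumes open_X: "open X"
    and f_diff: "\<And>z. z \<in> X \<times> - {0} \<Longrightarrow> f differentiable (at z)"
    and \<rho>_diff: "\<And>z. z \<in> X \<times> - {0} \<Longrightarrow> \<rho> differentiable (at z)"
    and S_diff: "\<And>z. z \<in> X \<times> - {0} \<Longrightarrow> S differentiable (at z)"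
    and H_diff: "\<And>z. z \<in> X \<times> - {0} \<Longrightarrow> H differentiable (at z)"
    and f_pos: "\<And>z. z \<in> X \<times> - {0} \<Longrightarrow> f z > 0"
    and f_scaleR: "\<And>x y t. x \<in> X \<Longrightarrow> y \<noteq> 0 \<Longrightarrow> t > 0 \<Longrightarrow> f (x, t *\<^sub>R y) = t * f (x, y)"
    and fst_S: "\<And>z. fst (S z) = snd z"
    and bracket_CH: "\<And>z. z \<in> X \<times> - {0} \<Longrightarrow> lie_bracket liouville H z = H z"
    and dJ_H: "\<And>z. z \<in> X \<times> - {0} \<Longrightarrow> dJ f z (H z) = 0"
    and bracket_SH: "\<And>z. z \<in> X \<times> - {0} \<Longrightarrow> lie_bracket S H z = \<rho> z *\<^sub>R tangent_structure (H z)"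
    and bracket_HV: "\<And>z. z \<in> X \<times> - {0} \<Longrightarrow> lie_bracket H (\<lambda>w. tangent_structure (H w)) z =
      S z + I z *\<^sub>R H z + J z *\<^sub>R tangent_structure (H z)"
begin

abbreviation "U \<equiv> X \<times> - {0::real^2}"
abbreviation "DH z \<equiv> frechet_derivative H (at z)"
abbreviation "DS z \<equiv> frechet_derivative S (at z)"

lemma open_U: "open U"
  using open_X by (intro open_Times) auto

lemma H_deriv: "z \<in> U \<Longrightarrow> (H has_derivative DH z) (at z)"
  and S_deriv: "z \<in> U \<Longrightarrow> (S has_derivative DS z) (at z)"
  using H_diff S_diff by (auto simp: frechet_derivative_works)

lemma linear_DH: "z \<in> U \<Longrightarrow> linear (DH z)" and linear_DS: "z \<in> U \<Longrightarrow> linear (DS z)"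
  using H_deriv S_deriv has_derivative_linear by blast+

text \<open>
  The spray is a second order field, so its \<open>x\<close>-component \<open>y\<close> is known and can be differentiated
  explicitly.
\<close>

lemma fst_DS:
  assumes "z \<in> U"
  shows "fst (DS z w) = snd w"
proof -
  have "((\<lambda>z. fst (S z)) has_derivative (\<lambda>w. fst (DS z w))) (at z)"
    using S_deriv[OF assms] by (rule has_derivative_fst)
  then have "(snd has_derivative (\<lambda>w. fst (DS z w))) (at z)"
    by (simp add: fst_S[abs_def])
  moreover have "(snd has_derivative snd) (at z)"
    by (rule bounded_linear_imp_has_derivative[OF bounded_linear_snd])
  ultimately show ?thesis using has_derivative_unique by metis
qed

text \<open>
  The factor \<open>2\<close> arises because \<open>[C, H] = H\<close> subtracts \<open>D C (H) = (0, b)\<close> from \<open>D\<^sub>y H (y)\<close>: the \<open>y\<close>-components of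
  a field of degree \<open>1\<close> are functions of degree \<open>2\<close>.
\<close>

lemma vertical_derivative_H:
  assumes "z \<in> U"
  shows "DH z (0, snd z) = (fst (H z), 2 *\<^sub>R snd (H z))"
proof -
  have "(liouville has_derivative (\<lambda>w. (0, snd w))) (at z)"
    unfolding liouville_def[abs_def]
    by (intro has_derivative_Pair has_derivative_const has_derivative_snd has_derivative_ident)
  then have "frechet_derivative liouville (at z) = (\<lambda>w. (0, snd w))"
    by (rule frechet_derivative_at[symmetric])
  then have "DH z (0, snd z) - (0, snd (H z)) = H z"
    using bracket_CH[OF assms] by (simp add: lie_bracket_def liouville_def)
  then have "DH z (0, snd z) = H z + (0, snd (H z))" by (simp add: diff_eq_eq)
  then show ?thesis by (simp add: prod_eq_iff scaleR_2)
qed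

lemma fibre_scale_in_U: "z \<in> U \<Longrightarrow> t > 0 \<Longrightarrow> fibre_scale t z \<in> U"
  by (auto simp: fibre_scale_def)

text \<open>
  A vector field of degree \<open>1\<close> is carried by the dilation to itself up to the factor \<open>t\<close>; on components
  this is degree \<open>1\<close> for \<open>dx\<close> and degree \<open>2\<close> for \<open>dy\<close>.
\<close>

lemma H_fibre_scale:
  assumes "z \<in> U" "t > 0"
  shows "H (fibre_scale t z) = t *\<^sub>R fibre_scale t (H z)"
proof -
  obtain x y where z: "z = (x, y)" "x \<in> X" "y \<noteq> 0" using assms(1) by auto
  have diff: "H differentiable (at (x, y'))" if "y' \<noteq> 0" for y'
    using H_diff z(2) that by simp
  have Hd: "(H has_derivative DH (x, y')) (at (x, y'))" if "y' \<noteq> 0" for y'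
    using H_deriv z(2) that by simp
  have D1: "((\<lambda>w. fst (H w)) has_derivative (\<lambda>h. fst (DH (x, y') h))) (at (x, y'))"
    and D2: "((\<lambda>w. snd (H w)) has_derivative (\<lambda>h. snd (DH (x, y') h))) (at (x, y'))" if "y' \<noteq> 0" for y'
    using Hd[OF that] by (auto intro: has_derivative_fst has_derivative_snd)
  have e: "DH (x, y') (0, y') = (fst (H (x, y')), 2 *\<^sub>R snd (H (x, y')))" if "y' \<noteq> 0" for y'
    using vertical_derivative_H[of "(x, y')"] z(2) that by simp
  have "fst (H (x, t *\<^sub>R y)) = t ^ 1 *\<^sub>R fst (H (x, y))"
    by (rule euler_homogeneous[where f = "\<lambda>w. fst (H w)"])
       (use D1 e z(3) assms(2) in \<open>auto simp: differentiable_def frechet_derivative_at[OF D1, symmetric]\<close>)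
  moreover have "snd (H (x, t *\<^sub>R y)) = t ^ 2 *\<^sub>R snd (H (x, y))"
    by (rule euler_homogeneous[where f = "\<lambda>w. snd (H w)"])
       (use D2 e z(3) assms(2) in \<open>auto simp: differentiable_def frechet_derivative_at[OF D2, symmetric]\<close>)
  ultimately show ?thesis by (simp add: z prod_eq_iff fibre_scale_def power2_eq_square)
qed

lemma DH_fibre_scale:
  assumes "z \<in> U" "t > 0"
  shows "DH (fibre_scale t z) (fibre_scale t w) = t *\<^sub>R fibre_scale t (DH z w)"
  by (rule frechet_derivative_equivariant[OF open_U])
     (use assms fibre_scale_in_U H_fibre_scale H_diff
        in \<open>auto intro: bounded_linear_fibre_scale bounded_linear_scaled_fibre_scale\<close>)

text \<open>
  The \<open>x\<close>-component of \<open>[H, V] = S + I H + J V\<close>, to which \<open>D V (H)\<close> and \<open>J V\<close> do not contribute because they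
  are vertical.
\<close>

lemma vertical_derivative_fst_H:
  assumes "z \<in> U"
  shows "fst (DH z (0, fst (H z))) = - (snd z + I z *\<^sub>R fst (H z))"
proof -
  have "((\<lambda>w. tangent_structure (H w)) has_derivative (\<lambda>h. (0, fst (DH z h)))) (at z)"
    unfolding tangent_structure_def
    by (intro has_derivative_Pair has_derivative_const has_derivative_fst H_deriv assms)
  note D = frechet_derivative_at[OF this, symmetric]
  have "- fst (DH z (0, fst (H z))) = fst (lie_bracket H (\<lambda>w. tangent_structure (H w)) z)"
    unfolding lie_bracket_def D by (simp add: tangent_structure_def)
  also have "\<dots> = snd z + I z *\<^sub>R fst (H z)"
    unfolding bracket_HV[OF assms] by (simp add: fst_S tangent_structure_def)
  finally show ?thesis by (metis minus_minus)
qed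

lemma fst_H_nonzero:
  assumes "z \<in> U"
  shows "fst (H z) \<noteq> 0"
proof
  assume "fst (H z) = 0"
  then have "snd z = 0"
    using vertical_derivative_fst_H[OF assms] linear_0[OF linear_DH[OF assms]]
    by (simp add: zero_prod_def)
  then show False using assms by auto
qed

lemma I_fibre_scale:
  assumes "z \<in> U" "t > 0"
  shows "I (fibre_scale t z) = I z"
proof -
  let ?w = "fibre_scale t z"
  have w: "?w \<in> U" using assms by (rule fibre_scale_in_U)
  have H: "fst (H ?w) = t *\<^sub>R fst (H z)" by (simp add: H_fibre_scale[OF assms])
  have "- (t *\<^sub>R snd z + (I ?w * t) *\<^sub>R fst (H z)) = fst (DH ?w (0, fst (H ?w)))"
    by (subst vertical_derivative_fst_H[OF w]) (simp add: H)
  also have "(0, fst (H ?w)) = fibre_scale t (0, fst (H z))"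
    unfolding H by (simp add: fibre_scale_Pair)
  also have "fst (DH ?w (fibre_scale t (0, fst (H z)))) = t *\<^sub>R fst (DH z (0, fst (H z)))"
    unfolding DH_fibre_scale[OF assms] by simp
  also have "\<dots> = - (t *\<^sub>R snd z + (I z * t) *\<^sub>R fst (H z))"
    unfolding vertical_derivative_fst_H[OF assms(1)] by (simp add: algebra_simps)
  finally show ?thesis using assms(2) fst_H_nonzero[OF assms(1)] by simp
qed

lemma vertical_derivative_f:
  assumes "z \<in> U"
  shows "frechet_derivative f (at z) (0, snd z) = f z"
    and "frechet_derivative f (at z) (0, fst (H z)) = 0"
proof -
  obtain x y where z: "z = (x, y)" "x \<in> X" "y \<noteq> 0" using assms by auto
  have D: "(f has_derivative frechet_derivative f (at (x, y))) (at (x, 1 *\<^sub>R y))"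
    using f_diff[OF assms] by (simp add: z frechet_derivative_works)
  have c: "((\<lambda>s::real. (x, s *\<^sub>R y)) has_derivative (\<lambda>h. (0, h *\<^sub>R y))) (at 1)"
    by (auto intro!: derivative_eq_intros)
  have "((\<lambda>s. f (x, s *\<^sub>R y)) has_derivative (\<lambda>h. frechet_derivative f (at (x, y)) (0, h *\<^sub>R y))) (at 1)"
    using c D by (rule has_derivative_compose)
  moreover have "((\<lambda>s. f (x, s *\<^sub>R y)) has_derivative (\<lambda>h. h * f (x, y))) (at 1)"
    by (rule has_derivative_transform_within_open[of "\<lambda>s. s * f (x, y)" _ _ _ "{0<..}"])
       (auto intro!: derivative_eq_intros simp: f_scaleR z)
  ultimately have "(\<lambda>h. frechet_derivative f (at (x, y)) (0, h *\<^sub>R y)) = (\<lambda>h. h * f (x, y))"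
    by (rule has_derivative_unique)
  from fun_cong[OF this, of 1] show "frechet_derivative f (at z) (0, snd z) = f z"
    by (simp add: z)
  show "frechet_derivative f (at z) (0, fst (H z)) = 0"
    using dJ_H[OF assms] by (simp add: dJ_def tangent_structure_def)
qed

text \<open>
  The derivative of \<open>f\<close> is positive on \<open>y\<close> and zero on \<open>a\<close>, so \<open>y\<close> is no multiple of \<open>a\<close>.
\<close>

lemma vertical_frame_independent:
  assumes "z \<in> U"
  shows "snd z $ 1 * fst (H z) $ 2 - snd z $ 2 * fst (H z) $ 1 \<noteq> 0"
proof
  assume "snd z $ 1 * fst (H z) $ 2 - snd z $ 2 * fst (H z) $ 1 = 0"
  then have "fst (H z) $ 1 * snd z $ 2 - fst (H z) $ 2 * snd z $ 1 = 0" by (simp add: mult.commute)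
  then obtain r where r: "snd z = r *\<^sub>R fst (H z)"
    using parallel_2[OF fst_H_nonzero[OF assms]] by blast
  have lin: "linear (frechet_derivative f (at z))"
    using f_diff[OF assms] by (auto simp: frechet_derivative_works intro: has_derivative_linear)
  have "f z = frechet_derivative f (at z) (0, r *\<^sub>R fst (H z))"
    using vertical_derivative_f(1)[OF assms] by (simp only: r)
  also have "\<dots> = r *\<^sub>R frechet_derivative f (at z) (0, fst (H z))"
    using linear_scale[OF lin, of r "(0, fst (H z))"] by simp
  also have "\<dots> = 0" using vertical_derivative_f(2)[OF assms] by simp
  finally show False using f_pos[OF assms] by simp
qed

text \<open>
  In the basis \<open>(y, a)\<close> the map \<open>D\<^sub>y a\<close> sends \<open>y\<close> to \<open>a\<close> and \<open>a\<close> to \<open>- y - I a\<close>, so its determinant is \<open>1\<close>.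
\<close>

lemma vertical_derivative_fst_H_inj:
  assumes "z \<in> U" "fst (DH z (0, v)) = 0"
  shows "v = 0"
proof -
  obtain r s where v: "v = r *\<^sub>R snd z + s *\<^sub>R fst (H z)"
    using vertical_frame_independent[OF assms(1)] by (rule span_pair_2)
  note lin = linear_DH[OF assms(1)]
  have v': "(0, v) = r *\<^sub>R (0, snd z) + s *\<^sub>R (0, fst (H z))" by (simp add: v)
  have "DH z (0, v) = r *\<^sub>R DH z (0, snd z) + s *\<^sub>R DH z (0, fst (H z))"
    unfolding v' by (simp only: linear_add[OF lin] linear_scale[OF lin])
  then have "(- s) *\<^sub>R snd z + (r - s * I z) *\<^sub>R fst (H z) = 0"
    using assms(2)
    by (simp add: vertical_derivative_H[OF assms(1)] vertical_derivative_fst_H[OF assms(1)] algebra_simps)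
  then have "- s = 0 \<and> r - s * I z = 0"
    by (rule independent_2_coeffs[OF vertical_frame_independent[OF assms(1)]])
  then show ?thesis by (simp add: v)
qed

text \<open>
  The \<open>x\<close>-component of \<open>[S, H] = \<rho> V\<close> is \<open>D a (S) = b\<close>.  Comparing it at \<open>z\<close> and at the dilated point, where both sides
  scale by \<open>t\<^sup>2\<close>, leaves a vertical vector killed by \<open>D\<^sub>y a\<close>.
\<close>

lemma S_fibre_scale:
  assumes "z \<in> U" "t > 0"
  shows "S (fibre_scale t z) = t *\<^sub>R fibre_scale t (S z)"
proof -
  let ?w = "fibre_scale t z"
  have w: "?w \<in> U" using assms by (rule fibre_scale_in_U)
  have b: "fst (DH z (S z)) = snd (H z)" if "z \<in> U" for z
    using arg_cong[OF bracket_SH[OF that], of fst]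
    by (simp add: lie_bracket_def fst_DS[OF that] tangent_structure_def)
  \<comment> \<open>The \<open>y\<close>-component of \<open>S\<close> at the dilated point, scaled back to \<open>z\<close>.\<close>
  define s where "s = (1 / t\<^sup>2) *\<^sub>R snd (S ?w)"
  have Sw: "S ?w = t *\<^sub>R fibre_scale t (snd z, s)"
    using assms(2) by (simp add: prod_eq_iff fst_S s_def power2_eq_square)
  have "t\<^sup>2 *\<^sub>R snd (H z) = fst (DH ?w (S ?w))"
    using b[OF w] by (simp add: H_fibre_scale[OF assms] power2_eq_square)
  also have "\<dots> = t\<^sup>2 *\<^sub>R fst (DH z (snd z, s))"
    unfolding Sw linear_scale[OF linear_DH[OF w]] DH_fibre_scale[OF assms]
    by (simp add: power2_eq_square)
  finally have "fst (DH z (snd z, s)) = fst (DH z (S z))"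
    using assms by (simp add: b)
  then have "fst (DH z ((snd z, s) - S z)) = 0"
    by (simp add: linear_diff[OF linear_DH[OF assms(1)]])
  moreover have "(snd z, s) - S z = (0, s - snd (S z))" by (simp add: prod_eq_iff fst_S)
  ultimately have "s = snd (S z)"
    using vertical_derivative_fst_H_inj[OF assms(1), of "s - snd (S z)"] by simp
  then show ?thesis using Sw by (simp add: prod_eq_iff fst_S power2_eq_square)
qed

lemma DS_fibre_scale:
  assumes "z \<in> U" "t > 0"
  shows "DS (fibre_scale t z) (fibre_scale t w) = t *\<^sub>R fibre_scale t (DS z w)"
  by (rule frechet_derivative_equivariant[OF open_U])
     (use assms fibre_scale_in_U S_fibre_scale S_diff
        in \<open>auto intro: bounded_linear_fibre_scale bounded_linear_scaled_fibre_scale\<close>)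

text \<open>
  \<open>S\<close> and \<open>H\<close> have degree \<open>1\<close>, hence \<open>[S, H]\<close> has degree \<open>2\<close>, while \<open>V\<close> is invariant under dilations.
\<close>

lemma \<rho>_fibre_scale:
  assumes "z \<in> U" "t > 0"
  shows "\<rho> (fibre_scale t z) = t\<^sup>2 * \<rho> z"
proof -
  let ?w = "fibre_scale t z"
  have w: "?w \<in> U" using assms by (rule fibre_scale_in_U)
  have "lie_bracket S H ?w = DH ?w (S ?w) - DS ?w (H ?w)" by (simp add: lie_bracket_def)
  also have "\<dots> = t *\<^sub>R (t *\<^sub>R fibre_scale t (DH z (S z)) - t *\<^sub>R fibre_scale t (DS z (H z)))"
    unfolding S_fibre_scale[OF assms] H_fibre_scale[OF assms]
      linear_scale[OF linear_DH[OF w]] linear_scale[OF linear_DS[OF w]]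
      DH_fibre_scale[OF assms] DS_fibre_scale[OF assms] by (simp only: scaleR_diff_right)
  also have "\<dots> = t\<^sup>2 *\<^sub>R fibre_scale t (lie_bracket S H z)"
    by (simp add: lie_bracket_def prod_eq_iff scaleR_diff_right power2_eq_square)
  finally have "\<rho> ?w *\<^sub>R (t *\<^sub>R fst (H z)) = (t * t\<^sup>2) *\<^sub>R (\<rho> z *\<^sub>R fst (H z))"
    unfolding bracket_SH[OF w] bracket_SH[OF assms(1)]
    by (simp add: prod_eq_iff tangent_structure_def H_fibre_scale[OF assms])
  then show ?thesis using assms(2) fst_H_nonzero[OF assms(1)] by simp
qed

text \<open>
  The two sides of \<open>V \<rho> = - I\<close> have degrees \<open>2\<close> and \<open>0\<close>; the dilation by \<open>2\<close> already forces \<open>- I = - 4 I\<close>.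
\<close>

lemma main_scalar_zero:
  assumes V_\<rho>: "\<And>z. z \<in> U \<Longrightarrow> lie_deriv (\<lambda>w. tangent_structure (H w)) \<rho> z = - I z"
    and "z \<in> U"
  shows "I z = 0"
proof -
  let ?w = "fibre_scale 2 z" and ?D = "\<lambda>z. frechet_derivative \<rho> (at z)"
  have w: "?w \<in> U" using assms(2) by (rule fibre_scale_in_U) simp
  have D: "?D z (0, fst (H z)) = - I z" if "z \<in> U" for z
    using V_\<rho>[OF that] by (simp add: lie_deriv_def tangent_structure_def)
  have "- I z = ?D ?w (0, fst (H ?w))"
    using D[OF w] I_fibre_scale[OF assms(2), of 2] by simp
  also have "(0, fst (H ?w)) = fibre_scale 2 (0, fst (H z))"
    by (simp add: H_fibre_scale[OF assms(2)] fibre_scale_Pair)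
  also have "?D ?w \<dots> = 2\<^sup>2 * ?D z (0, fst (H z))"
    by (rule frechet_derivative_equivariant[where m = "fibre_scale 2" and n = "\<lambda>r. 2\<^sup>2 * r",
          OF open_U assms(2) w])
       (use \<rho>_fibre_scale \<rho>_diff in \<open>auto intro: bounded_linear_fibre_scale bounded_linear_mult_right\<close>)
  also have "\<dots> = - 4 * I z" by (simp add: D[OF assms(2)])
  finally show ?thesis by simp
qed

lemma quadratic:
  assumes I: "\<And>z. z \<in> U \<Longrightarrow> I z = 0" and x: "x \<in> X"
  obtains a :: "real^2^2" where
    "\<And>y. y \<noteq> 0 \<Longrightarrow> (f (x, y))\<^sup>2 = (\<Sum>i\<in>UNIV. \<Sum>j\<in>UNIV. a $ i $ j * y $ i * y $ j)"
proof (rule quadratic_of_frame)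
  let ?Df = "\<lambda>y. frechet_derivative f (at (x, y))"
  have U: "(x, y) \<in> U" if "y \<noteq> 0" for y using that x by simp
  have c: "(Pair x has_derivative (\<lambda>h. (0, h))) (at y)" for y :: "real^2"
    by (auto intro!: derivative_eq_intros)
  fix y :: "real^2" assume "y \<noteq> 0"
  note z = U[OF this]
  show "((\<lambda>y. fst (H (x, y))) has_derivative (\<lambda>h. fst (DH (x, y) (0, h)))) (at y)"
    by (intro has_derivative_fst has_derivative_compose[OF c] H_deriv z)
  show "fst (DH (x, y) (0, y)) = fst (H (x, y))"
    using vertical_derivative_H[OF z] by simp
  show "fst (DH (x, y) (0, fst (H (x, y)))) = - y"
    using vertical_derivative_fst_H[OF z] I[OF z] by simp
  show "y $ 1 * fst (H (x, y)) $ 2 - y $ 2 * fst (H (x, y)) $ 1 \<noteq> 0"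
    using vertical_frame_independent[OF z] by simp
  have "((\<lambda>y. f (x, y)) has_derivative (\<lambda>h. ?Df y (0, h))) (at y)"
    by (rule has_derivative_compose[OF c]) (use f_diff[OF z] in \<open>simp add: frechet_derivative_works\<close>)
  from has_derivative_mult[OF this this]
  show "((\<lambda>y. (f (x, y))\<^sup>2) has_derivative (\<lambda>h. 2 * f (x, y) * ?Df y (0, h))) (at y)"
    by (simp add: power2_eq_square algebra_simps)
  show "2 * f (x, y) * ?Df y (0, y) = 2 * (f (x, y))\<^sup>2"
    using vertical_derivative_f(1)[OF z] by (simp add: power2_eq_square)
  show "2 * f (x, y) * ?Df y (0, fst (H (x, y))) = 0"
    using vertical_derivative_f(2)[OF z] by simp
  show "(f (x, y))\<^sup>2 > 0" using f_pos[OF z] by simp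
qed (rule that)

end

section \<open>Surfaces whose main scalar is the vertical derivative of the Ricci scalar\<close>

theorem theorem5p7:
  fixes A :: "'a::{t2_space, second_countable_topology} chart set"
    and F K mI mJ :: "'a tvec \<Rightarrow> real"
    and H :: "'a field"
  assumes atlas: "smooth_atlas A"
    and finsler: "finsler_function A F"
    and flag: "flag_curvature A F K"
    and nonflat: "\<forall>u\<in>slit_bundle A. K u \<noteq> 0"
    and frame: "berwald_frame A F K H mI mJ"
    and V_ricci: "\<forall>c\<in>A. \<forall>z\<in>slit c.
      lie_deriv (vertical_part H c) (local_rep A (ricci_scalar F K) c) z = - local_rep A mI c z"
    and S_cases:
      "(\<forall>c\<in>A. \<forall>z\<in>slit c.
          lie_deriv (geodesic_spray A F c) (local_rep A (ricci_scalar F K) c) z = 0) \<or>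
       (\<forall>c\<in>A. \<forall>z\<in>slit c. lie_deriv (geodesic_spray A F c) (local_rep A mJ c) z = 0)"
  shows "riemannian A F"
  unfolding riemannian_def
proof (intro ballI)
  fix c x assume c: "c \<in> A" and x: "x \<in> chart_image c"
  let ?f = "local_rep A F c" and ?\<rho> = "local_rep A (ricci_scalar F K) c"
  have opn: "open (chart_image c)" using atlas c by (auto simp: smooth_atlas_def)
  then have slit: "open (slit c)" unfolding slit_def by (intro open_Times) auto
  have F: "smooth_on (slit c) ?f"
    using finsler c by (auto simp: finsler_function_def smooth_scalar_def)
  have K: "smooth_on (slit c) (local_rep A K c)"
    using flag c by (auto simp: flag_curvature_def smooth_scalar_def)
  have "smooth_on (slit c) (\<lambda>z. local_rep A K c z * (?f z * ?f z))"
    using slit F K by (intro smooth_on_mult)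
  then have \<rho>: "smooth_on (slit c) ?\<rho>"
    by (simp add: local_rep_def ricci_scalar_def power2_eq_square comp_def)
  have H: "smooth_on (slit c) (H c)"
    using frame c by (auto simp: berwald_frame_def vector_field_def)
  have rank: "\<And>z. z \<in> slit c \<Longrightarrow> rank (metric A F c z) = 2"
    using finsler c by (auto simp: finsler_function_def)
  have V: "vertical_part H c = (\<lambda>z. tangent_structure (H c z))"
    by (simp add: fun_eq_iff vertical_part_def)
  have frame_c: "lie_bracket liouville (H c) z = H c z \<and> dJ ?f z (H c z) = 0 \<and>
      lie_bracket (geodesic_spray A F c) (H c) z = ?\<rho> z *\<^sub>R vertical_part H c z \<and>
      lie_bracket (H c) (vertical_part H c) z = geodesic_spray A F c z
        + local_rep A mI c z *\<^sub>R H c z + local_rep A mJ c z *\<^sub>R vertical_part H c z"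
    if "z \<in> slit c" for z
    using frame c that unfolding berwald_frame_def Let_def by blast
  interpret berwald_chart "chart_image c" ?f ?\<rho> "local_rep A mI c" "local_rep A mJ c"
    "geodesic_spray A F c" "H c"
    unfolding berwald_chart_def slit_def[symmetric]
  proof (intro conjI allI impI)
    show "geodesic_spray A F c differentiable (at z)" if "z \<in> slit c" for z
      using slit F rank that by (rule geodesic_spray_differentiable)
    show "?f z > 0" if "z \<in> slit c" for z
      using that local_rep_pos[OF atlas finsler c] by (auto simp: slit_def)
    show "?f (x, t *\<^sub>R y) = t * ?f (x, y)" if "x \<in> chart_image c" "t > 0" for x y t
      using local_rep_scaleR[OF atlas finsler c that] .
  qed (use opn F \<rho> H frame_c in \<open>auto simp: V geodesic_spray_def intro: smooth_on_imp_differentiable\<close>)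
  have "lie_deriv (\<lambda>w. tangent_structure (H c w)) ?\<rho> z = - local_rep A mI c z" if "z \<in> slit c" for z
    using V_ricci[rule_format, OF c that] by (simp only: V)
  then have "local_rep A mI c z = 0" if "z \<in> slit c" for z
    using that unfolding slit_def by (rule main_scalar_zero)
  then obtain a :: "real^2^2" where
    a: "\<And>y. y \<noteq> 0 \<Longrightarrow> (?f (x, y))\<^sup>2 = (\<Sum>i\<in>UNIV. \<Sum>j\<in>UNIV. a $ i $ j * y $ i * y $ j)"
    using quadratic[OF _ x] unfolding slit_def by blast
  have "(?f (x, y))\<^sup>2 = (\<Sum>i\<in>UNIV. \<Sum>j\<in>UNIV. a $ i $ j * y $ i * y $ j)" for y :: "real^2"
  proof (cases "y = 0")
    case True
    then show ?thesis using local_rep_0[OF atlas finsler c x] by simp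
  next
    case False
    then show ?thesis by (rule a)
  qed
  then show "\<exists>a::real^2^2. \<forall>y. (?f (x, y))\<^sup>2 = (\<Sum>i\<in>UNIV. \<Sum>j\<in>UNIV. a $ i $ j * y $ i * y $ j)"
    by blast
qed

end
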